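(* Let $0<a<b$ be real numbers. Then for all $\lambda\in[0,1]$, $$e^{\frac{\lambda(1-\lambda)(a-b)^2}{2b^2}}\le \frac{\lambda a+(1-\lambda)b}{a^{\lambda}b^{1-\lambda}}\le e^{\frac{\lambda(1-\lambda)(a-b)^2}{2a^2}}.$$ *)

theory Defs
  imports Complex_Main
begin

end

theory Submission
  imports Defs "HOL-Analysis.Convex"
begin

text \<open>
  Taking logarithms, the quotient of the weighted arithmetic mean by the weighted geometric mean
  becomes the Jensen gap of \<open>- ln\<close> at the points \<open>a\<close> and \<open>b\<close>. On \<open>[a, b]\<close> the second derivative
  \<open>1 / x\<^sup>2\<close> of \<open>- ln\<close> lies between \<open>1 / b\<^sup>2\<close> and \<open>1 / a\<^sup>2\<close>, and the Jensen gap of a function is at least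
  that of any quadratic with a smaller second derivative (lemma \<open>jensen_gap_ge\<close>). Applied to \<open>- ln\<close>
  this gives the lower bound, applied to \<open>ln\<close> the upper bound.
\<close>

text \<open>
  Subtracting the quadratic \<open>m * x\<^sup>2 / 2\<close> from \<open>f\<close> leaves a convex function, and the Jensen gap of
  \<open>x\<^sup>2\<close> is exactly \<open>l * (1 - l) * (a - b)\<^sup>2\<close>. The constant \<open>m\<close> may be negative, so that upper bounds on
  a gap follow by applying the lemma to \<open>- f\<close>.
\<close>
lemma jensen_gap_ge:
  fixes f f' f'' :: "real \<Rightarrow> real"
  assumes "a \<le> b" and l: "0 \<le> l" "l \<le> 1"
    and f': "\<And>x. x \<in> {a..b} \<Longrightarrow> (f has_real_derivative f' x) (at x)"
    and f'': "\<And>x. x \<in> {a..b} \<Longrightarrow> (f' has_real_derivative f'' x) (at x)"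
    and m: "\<And>x. x \<in> {a..b} \<Longrightarrow> m \<le> f'' x"
  shows "m * (l * (1 - l) * (a - b)\<^sup>2) / 2 \<le> l * f a + (1 - l) * f b - f (l * a + (1 - l) * b)"
proof -
  define g where "g x = f x - m * x\<^sup>2 / 2" for x
  have "convex_on {a..b} g"
  proof (rule f''_ge0_imp_convex)
    show "(g has_real_derivative f' x - m * x) (at x)" if "x \<in> {a..b}" for x
      unfolding g_def by (auto intro!: derivative_eq_intros f' that)
    show "((\<lambda>x. f' x - m * x) has_real_derivative f'' x - m) (at x)" if "x \<in> {a..b}" for x
      by (auto intro!: derivative_eq_intros f'' that)
  qed (use m in auto)
  from convex_onD_Icc[OF this \<open>a \<le> b\<close>, of "1 - l"] l
  have "g (l * a + (1 - l) * b) \<le> l * g a + (1 - l) * g b"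
    by simp
  then have "m * (l * a\<^sup>2 + (1 - l) * b\<^sup>2 - (l * a + (1 - l) * b)\<^sup>2) / 2
      \<le> l * f a + (1 - l) * f b - f (l * a + (1 - l) * b)"
    by (simp add: g_def algebra_simps diff_divide_distrib add_divide_distrib)
  moreover have "l * a\<^sup>2 + (1 - l) * b\<^sup>2 - (l * a + (1 - l) * b)\<^sup>2 = l * (1 - l) * (a - b)\<^sup>2"
    by (simp add: power2_eq_square algebra_simps)
  ultimately show ?thesis
    by simp
qed

theorem mainTheorem4:
  fixes a b :: real
  assumes "0 < a" and "a < b"
  shows "\<forall>l\<in>{0..1::real}.
           exp (l * (1 - l) * (a - b)\<^sup>2 / (2 * b\<^sup>2))
             \<le> (l * a + (1 - l) * b) / (a powr l * b powr (1 - l)) \<and>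
           (l * a + (1 - l) * b) / (a powr l * b powr (1 - l))
             \<le> exp (l * (1 - l) * (a - b)\<^sup>2 / (2 * a\<^sup>2))"
proof
  fix l :: real
  assume "l \<in> {0..1}"
  then have l: "0 \<le> l" "l \<le> 1" by auto
  have "0 < b" using assms by simp
  define A where "A = l * a + (1 - l) * b"
  define gap where "gap = ln A - l * ln a - (1 - l) * ln b"
  have "a \<le> A"
    using mult_left_mono[of a b "1 - l"] assms l by (simp add: A_def algebra_simps)
  then have "0 < A" using assms by simp
  have quotient: "A / (a powr l * b powr (1 - l)) = exp gap"
    using \<open>0 < A\<close> \<open>0 < a\<close> \<open>0 < b\<close>
    by (simp add: gap_def powr_def exp_diff)
  have "(1 / b\<^sup>2) * (l * (1 - l) * (a - b)\<^sup>2) / 2 \<le> l * (- ln a) + (1 - l) * (- ln b) - (- ln A)"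
    unfolding A_def
  proof (rule jensen_gap_ge[where f' = "\<lambda>x. - (1 / x)" and f'' = "\<lambda>x. 1 / x\<^sup>2"])
    fix x assume x: "x \<in> {a..b}"
    then have "0 < x" using assms by simp
    then show "((\<lambda>x. - ln x) has_real_derivative - (1 / x)) (at x)"
      and "((\<lambda>x. - (1 / x)) has_real_derivative 1 / x\<^sup>2) (at x)"
      by (auto intro!: derivative_eq_intros simp: power2_eq_square)
    show "1 / b\<^sup>2 \<le> 1 / x\<^sup>2"
      using x \<open>0 < x\<close> by (intro divide_left_mono power_mono) auto
  qed (use assms l in auto)
  then have lower: "l * (1 - l) * (a - b)\<^sup>2 / (2 * b\<^sup>2) \<le> gap"
    by (simp add: gap_def mult.commute)
  have "- (1 / a\<^sup>2) * (l * (1 - l) * (a - b)\<^sup>2) / 2 \<le> l * ln a + (1 - l) * ln b - ln A"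
    unfolding A_def
  proof (rule jensen_gap_ge[where f' = "\<lambda>x. 1 / x" and f'' = "\<lambda>x. - (1 / x\<^sup>2)"])
    fix x assume x: "x \<in> {a..b}"
    then have "0 < x" using assms by simp
    then show "(ln has_real_derivative 1 / x) (at x)"
      and "((\<lambda>x. 1 / x) has_real_derivative - (1 / x\<^sup>2)) (at x)"
      by (auto intro!: derivative_eq_intros simp: power2_eq_square)
    have "1 / x\<^sup>2 \<le> 1 / a\<^sup>2"
      using x \<open>0 < x\<close> \<open>0 < a\<close> by (intro divide_left_mono power_mono) auto
    then show "- (1 / a\<^sup>2) \<le> - (1 / x\<^sup>2)" by simp
  qed (use assms l in auto)
  then have upper: "gap \<le> l * (1 - l) * (a - b)\<^sup>2 / (2 * a\<^sup>2)"
    by (simp add: gap_def mult.commute)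
  show "exp (l * (1 - l) * (a - b)\<^sup>2 / (2 * b\<^sup>2))
             \<le> (l * a + (1 - l) * b) / (a powr l * b powr (1 - l)) \<and>
           (l * a + (1 - l) * b) / (a powr l * b powr (1 - l))
             \<le> exp (l * (1 - l) * (a - b)\<^sup>2 / (2 * a\<^sup>2))"
    using lower upper quotient unfolding A_def by simp
qed

end
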